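(* Let $0<p<1$, $A\in\mathbb{R}^{m\times n}$, $\bm{b}\in\mathbb{R}^m$ and $\sigma\ge0$ be such that $\mathcal{F}:=\{\bm{x}\in\mathbb{R}^n:\|A\bm{x}-\bm{b}\|_1\le\sigma\}\ne\emptyset$ and $\|\bm{b}\|_1>\sigma$. Suppose that $\rho>1$ and $0<\theta<1$ are chosen such that $\theta\rho\le1$. Let $\{\bm{x}^k\}_{k=0}^\infty$ be a sequence generated by the smoothing penalty method SPeL1 (described in the context) for problem $$\min_{\bm{x}\in\mathbb{R}^n}\ \|\bm{x}\|_p^p\quad\text{s.t.}\quad\|A\bm{x}-\bm{b}\|_1\le\sigma. \qquad (P)$$ Then the following statements hold. (i) $\{\bm{x}^k\}$ is bounded. (ii) Any cluster point $\bm{x}^*$ of $\{\bm{x}^k\}$ is a feasible point of $(P)$. (iii) Suppose that $\bm{x}^*$ is a cluster point of $\{\bm{x}^k\}$ and that $$-\partial^\infty\Phi(\bm{x}^* )\cap\mathcal{N}_{\mathcal{F}}(\bm{x}^* )=\{0\},$$ where $\Phi(\bm{x}):=\|\bm{x}\|_p^p$. Then $\bm{x}^*$ is a stationary point of $(P)$.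
   Context: Notation: $\|\bm{x}\|_p^p:=\sum_{i=1}^n|x_i|^p$, $(s)_+:=\max\{s,0\}$, $\mathrm{dist}$ is Euclidean distance to a set, and $\mathcal{N}_{\mathcal{F}}(\bm{x})$ is the normal cone of the closed convex set $\mathcal{F}$ at $\bm{x}\in\mathcal{F}$. $\delta_{\mathcal{F}}$ is the indicator function of $\mathcal{F}$ ($0$ on $\mathcal{F}$, $+\infty$ elsewhere). Subdifferentials: for a proper closed function $f$ and $\bm{x}\in\mathrm{dom}\,f$, $\widehat{\partial}f(\bm{x}):=\{\bm{d}\in\mathbb{R}^n:\liminf_{\bm{y}\to\bm{x},\,\bm{y}\ne\bm{x}}\frac{f(\bm{y})-f(\bm{x})-\langle\bm{d},\bm{y}-\bm{x}\rangle}{\|\bm{y}-\bm{x}\|}\ge0\}$; $\partial f(\bm{x}):=\{\bm{d}:\exists\,\bm{x}^k\to\bm{x}\text{ with }f(\bm{x}^k)\to f(\bm{x}),\ \bm{d}^k\to\bm{d},\ \bm{d}^k\in\widehat{\partial}f(\bm{x}^k)\}$; $\partial^\infty f(\bm{x}):=\{\bm{d}:\exists\,\bm{x}^k\to\bm{x}\text{ with }f(\bm{x}^k)\to f(\bm{x}),\ \lambda_k\downarrow0,\ \lambda_k\bm{d}^k\to\bm{d},\ \bm{d}^k\in\widehat{\partial}f(\bm{x}^k)\}$. Stationary point: $\bm{x}^*$ is a stationary point of $(P)$ if $\bm{x}^*\in\mathcal{F}$ and $0\in\partial(\Phi+\delta_{\mathcal{F}})(\bm{x}^* )$. Smoothing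 functions: for $\lambda,\mu,\nu>0$, $$g_\mu(s):=\begin{cases}(s)_+,&|s|\ge\frac\mu2,\\ \frac{s^2}{2\mu}+\frac s2+\frac\mu8,&|s|<\frac\mu2,\end{cases}\qquad h_\nu(t):=\begin{cases}|t|,&|t|\ge\frac\nu2,\\ \frac{t^2}{\nu}+\frac\nu4,&|t|<\frac\nu2,\end{cases}\qquad H_\nu(\bm{z}):=\sum_{i=1}^mh_\nu(z_i),$$ $f_{\lambda,\mu,\nu}(\bm{x}):=\lambda\,g_\mu\big(H_\nu(A\bm{x}-\bm{b})-\sigma\big)$ (continuously differentiable), and $F_{\lambda,\mu,\nu}(\bm{x}):=\Phi(\bm{x})+f_{\lambda,\mu,\nu}(\bm{x})$. Algorithm SPeL1. Input: a feasible point $\bm{x}^{\mathrm{feas}}\in\mathcal{F}$, $\lambda_0,\mu_0,\nu_0,\epsilon_0>0$, $\rho>1$, $0<\theta<1$. Set $\bm{x}^0=\bm{x}^{\mathrm{feas}}$. For $k=0,1,2,\dots$ (the algorithm is run indefinitely): Step 1. If $F_{\lambda_k,\mu_k,\nu_k}(\bm{x}^k)\le F_{\lambda_k,\mu_k,\nu_k}(\bm{x}^{\mathrm{feas}})$, set $\bm{x}^{k,0}=\bm{x}^k$; otherwise set $\bm{x}^{k,0}=\bm{x}^{\mathrm{feas}}$. Step 2. By some method started at $\bm{x}^{k,0}$, find points $\bm{x}^{k,l_k}$ and $\bm{x}^{k,l_k+1}$ (two consecutive iterates of that method) such that $\mathrm{dist}\big(0,\ \partial\Phi(\bm{x}^{k,l_k+1})+\nabla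 f_{\lambda_k,\mu_k,\nu_k}(\bm{x}^{k,l_k})\big)\le\epsilon_k$, $\|\bm{x}^{k,l_k+1}-\bm{x}^{k,l_k}\|_2\le\epsilon_k$, and $F_{\lambda_k,\mu_k,\nu_k}(\bm{x}^{k,l_k})-F_{\lambda_k,\mu_k,\nu_k}(\bm{x}^{k,0})\le0$. Step 3. Set $\bm{x}^{k+1}=\bm{x}^{k,l_k}$, $\lambda_{k+1}=\rho\lambda_k$, $\mu_{k+1}=\theta\mu_k$, $\nu_{k+1}=\theta\nu_k$, $\epsilon_{k+1}=\theta\epsilon_k$. *)

theory Defs
  imports "HOL-Analysis.Analysis"
begin

(* The three subdifferentials are empty at points where f is not finite.  Points y outside
   the domain of f contribute the quotient +oo to the lower limit. *)

definition frechet_subdiff :: "('a::euclidean_space \<Rightarrow> ereal) \<Rightarrow> 'a \<Rightarrow> 'a set" where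
  "frechet_subdiff f x =
    {d. \<bar>f x\<bar> \<noteq> \<infinity> \<and>
        Liminf (at x) (\<lambda>y. (f y - f x - ereal (d \<bullet> (y - x))) / ereal (norm (y - x))) \<ge> 0}"

definition limiting_subdiff :: "('a::euclidean_space \<Rightarrow> ereal) \<Rightarrow> 'a \<Rightarrow> 'a set" where
  "limiting_subdiff f x =
    {d. \<bar>f x\<bar> \<noteq> \<infinity> \<and>
        (\<exists>X D. X \<longlonglongrightarrow> x \<and> (\<lambda>k. f (X k)) \<longlonglongrightarrow> f x \<and> D \<longlonglongrightarrow> d \<and>
               (\<forall>k. D k \<in> frechet_subdiff f (X k)))}"

definition horizon_subdiff :: "('a::euclidean_space \<Rightarrow> ereal) \<Rightarrow> 'a \<Rightarrow> 'a set" where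
  "horizon_subdiff f x =
    {d. \<bar>f x\<bar> \<noteq> \<infinity> \<and>
        (\<exists>X D t. X \<longlonglongrightarrow> x \<and> (\<lambda>k. f (X k)) \<longlonglongrightarrow> f x \<and>
               (\<forall>k. t k > 0) \<and> decseq t \<and> t \<longlonglongrightarrow> (0::real) \<and>
               (\<lambda>k. t k *\<^sub>R D k) \<longlonglongrightarrow> d \<and>
               (\<forall>k. D k \<in> frechet_subdiff f (X k)))}"

definition indicator_fn :: "'a set \<Rightarrow> 'a \<Rightarrow> ereal" where
  "indicator_fn S x = (if x \<in> S then 0 else \<infinity>)"

definition normal_cone :: "'a::euclidean_space set \<Rightarrow> 'a \<Rightarrow> 'a set" where
  "normal_cone S x = {d. x \<in> S \<and> (\<forall>y\<in>S. d \<bullet> (y - x) \<le> 0)}"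

definition stationary_point :: "('a::euclidean_space \<Rightarrow> real) \<Rightarrow> 'a set \<Rightarrow> 'a \<Rightarrow> bool" where
  "stationary_point \<Phi> S x \<longleftrightarrow>
    x \<in> S \<and> 0 \<in> limiting_subdiff (\<lambda>y. ereal (\<Phi> y) + indicator_fn S y) x"

(* Unspecified where f is not differentiable; f_penalty below is continuously differentiable
   for positive parameters. *)

definition gradient :: "('a::euclidean_space \<Rightarrow> real) \<Rightarrow> 'a \<Rightarrow> 'a" where
  "gradient f x = (THE d. GDERIV f x :> d)"

definition cluster_point :: "(nat \<Rightarrow> 'a::topological_space) \<Rightarrow> 'a \<Rightarrow> bool" where
  "cluster_point X x \<longleftrightarrow> (\<exists>r. strict_mono r \<and> (X \<circ> r) \<longlonglongrightarrow> x)"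

definition l1_norm :: "real ^ 'n \<Rightarrow> real" where
  "l1_norm x = (\<Sum>i\<in>UNIV. \<bar>x $ i\<bar>)"

definition lp_pow :: "real \<Rightarrow> real ^ 'n \<Rightarrow> real" where
  "lp_pow p x = (\<Sum>i\<in>UNIV. \<bar>x $ i\<bar> powr p)"

definition feasible_set :: "real ^ 'n ^ 'm \<Rightarrow> real ^ 'm \<Rightarrow> real \<Rightarrow> (real ^ 'n) set" where
  "feasible_set A b \<sigma> = {x. l1_norm (A *v x - b) \<le> \<sigma>}"

definition g_smooth :: "real \<Rightarrow> real \<Rightarrow> real" where
  "g_smooth \<mu> s =
    (if \<bar>s\<bar> \<ge> \<mu> / 2 then max s 0 else s\<^sup>2 / (2 * \<mu>) + s / 2 + \<mu> / 8)"

definition h_smooth :: "real \<Rightarrow> real \<Rightarrow> real" where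
  "h_smooth \<nu> t = (if \<bar>t\<bar> \<ge> \<nu> / 2 then \<bar>t\<bar> else t\<^sup>2 / \<nu> + \<nu> / 4)"

definition H_smooth :: "real \<Rightarrow> real ^ 'm \<Rightarrow> real" where
  "H_smooth \<nu> z = (\<Sum>i\<in>UNIV. h_smooth \<nu> (z $ i))"

definition f_penalty ::
  "real ^ 'n ^ 'm \<Rightarrow> real ^ 'm \<Rightarrow> real \<Rightarrow> real \<Rightarrow> real \<Rightarrow> real \<Rightarrow> real ^ 'n \<Rightarrow> real" where
  "f_penalty A b \<sigma> lam \<mu> \<nu> x = lam * g_smooth \<mu> (H_smooth \<nu> (A *v x - b) - \<sigma>)"

definition F_penalty ::
  "(real ^ 'n \<Rightarrow> real) \<Rightarrow> real ^ 'n ^ 'm \<Rightarrow> real ^ 'm \<Rightarrow> real \<Rightarrow> real \<Rightarrow> real \<Rightarrow> real \<Rightarrow> real ^ 'n \<Rightarrow> real"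
  where
  "F_penalty \<Phi> A b \<sigma> lam \<mu> \<nu> x = \<Phi> x + f_penalty A b \<sigma> lam \<mu> \<nu> x"

(* The sequence w k lists the inner iterates x^{k,0}, x^{k,1}, ... of the k-th outer iteration.
   As the inner method is arbitrary, nothing is known about w k except its starting point and
   the termination conditions met at the index l k.

   The subdifferential of Phi is required to be nonempty because infdist to the empty set is 0
   in the library, whereas the distance to the empty set is +oo by the usual convention. *)

definition SPeL1_sequence ::
  "(real ^ 'n \<Rightarrow> real) \<Rightarrow> real ^ 'n ^ 'm \<Rightarrow> real ^ 'm \<Rightarrow> real \<Rightarrow> real \<Rightarrow> real \<Rightarrow> (nat \<Rightarrow> real ^ 'n) \<Rightarrow> bool"
  where
  "SPeL1_sequence \<Phi> A b \<sigma> \<rho> \<theta> x \<longleftrightarrow>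
    (\<exists>(xfeas :: real ^ 'n) (lam :: nat \<Rightarrow> real) (\<mu> :: nat \<Rightarrow> real) (\<nu> :: nat \<Rightarrow> real)
      (\<epsilon> :: nat \<Rightarrow> real) (w :: nat \<Rightarrow> nat \<Rightarrow> real ^ 'n) (l :: nat \<Rightarrow> nat).
      xfeas \<in> feasible_set A b \<sigma> \<and>
      lam 0 > 0 \<and> \<mu> 0 > 0 \<and> \<nu> 0 > 0 \<and> \<epsilon> 0 > 0 \<and>
      x 0 = xfeas \<and>
      (\<forall>k.
        w k 0 =
          (if F_penalty \<Phi> A b \<sigma> (lam k) (\<mu> k) (\<nu> k) (x k)
              \<le> F_penalty \<Phi> A b \<sigma> (lam k) (\<mu> k) (\<nu> k) xfeas
           then x k else xfeas) \<and>
        limiting_subdiff (\<lambda>y. ereal (\<Phi> y)) (w k (Suc (l k))) \<noteq> {} \<and>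
        infdist 0
          ((\<lambda>d. d + gradient (f_penalty A b \<sigma> (lam k) (\<mu> k) (\<nu> k)) (w k (l k)))
            ` limiting_subdiff (\<lambda>y. ereal (\<Phi> y)) (w k (Suc (l k)))) \<le> \<epsilon> k \<and>
        norm (w k (Suc (l k)) - w k (l k)) \<le> \<epsilon> k \<and>
        F_penalty \<Phi> A b \<sigma> (lam k) (\<mu> k) (\<nu> k) (w k (l k))
          - F_penalty \<Phi> A b \<sigma> (lam k) (\<mu> k) (\<nu> k) (w k 0) \<le> 0 \<and>
        x (Suc k) = w k (l k) \<and>
        lam (Suc k) = \<rho> * lam k \<and>
        \<mu> (Suc k) = \<theta> * \<mu> k \<and>
        \<nu> (Suc k) = \<theta> * \<nu> k \<and>
        \<epsilon> (Suc k) = \<theta> * \<epsilon> k))"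

end

theory Submission
  imports Defs
begin

text \<open>
  The penalized objective stays below its value at the feasible point, which is bounded because
  \<open>\<lambda>\<^sub>k \<mu>\<^sub>k\<close> and \<open>\<lambda>\<^sub>k \<nu>\<^sub>k\<close> are bounded (\<open>\<theta> \<rho> \<le> 1\<close>); this bounds the iterates, and as
  \<open>\<lambda>\<^sub>k\<close> tends to infinity it forces the constraint violation to vanish.

  For stationarity at a cluster point \<open>x\<close>, the gradients \<open>v\<^sub>k\<close> of the penalty terms eventually belong
  to the normal cone \<open>N\<close> of the feasible set at \<open>x\<close> itself, and \<open>d\<^sub>k + v\<^sub>k\<close> tends to \<open>0\<close> for
  subgradients \<open>d\<^sub>k\<close> of \<open>\<Phi>\<close> near \<open>x\<close>.  On the support of \<open>x\<close> the \<open>d\<^sub>k\<close> converge to the gradient \<open>s\<close> of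
  \<open>\<Phi>\<close>; the remaining components form the subspace \<open>L\<close> of vectors vanishing on that support, which
  lies in the horizon subdifferential.  The constraint qualification makes \<open>N \<inter> L\<close> trivial, hence
  \<open>N + L\<close> is closed and contains \<open>- s\<close>.  So \<open>- v\<close> is a subgradient of \<open>\<Phi>\<close> at \<open>x\<close> for some \<open>v\<close> in \<open>N\<close>;
  since Frechet subgradients add up, \<open>0\<close> is one of \<open>\<Phi>\<close> plus the indicator.
\<close>

section \<open>Subdifferentials of \<open>lp_pow\<close>\<close>

text \<open>Clearing the positive denominator \<open>norm (y - x)\<close> turns the lower limit into
  affine minorants with slack \<open>e\<close>, free of extended-real division. Infinite values of
  \<open>f y\<close> cause no trouble: at +infinity both inequalities hold, at -infinity both
  fail.\<close>

lemma frechet_subdiff_iff: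
  fixes f :: "'a::euclidean_space \<Rightarrow> ereal"
  assumes "f x = ereal a"
  shows "d \<in> frechet_subdiff f x \<longleftrightarrow>
    (\<forall>e>0. \<forall>\<^sub>F y in at x. ereal (a + d \<bullet> (y - x) - e * norm (y - x)) \<le> f y)"
    (is "_ \<longleftrightarrow> ?R")
proof -
  define q where "q y = (f y - f x - ereal (d \<bullet> (y - x))) / ereal (norm (y - x))" for y
  have q_le: "ereal (- e) \<le> q y \<longleftrightarrow> ereal (a + d \<bullet> (y - x) - e * norm (y - x)) \<le> f y"
    if "y \<noteq> x" for e y
  proof (cases "f y")
    case (real r)
    then show ?thesis
      using that by (simp add: q_def assms pos_le_divide_eq) (simp add: algebra_simps)
  qed (use that in \<open>simp_all add: q_def assms\<close>)
  have ne: "\<forall>\<^sub>F y in at x. y \<noteq> x"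
    by (simp add: eventually_at_filter)
  have "0 \<le> Liminf (at x) q \<longleftrightarrow> (\<forall>e>0. \<forall>\<^sub>F y in at x. ereal (- e) \<le> q y)"
  proof
    assume "0 \<le> Liminf (at x) q"
    then have *: "\<forall>c<0. \<forall>\<^sub>F y in at x. c < q y"
      by (simp add: le_Liminf_iff)
    show "\<forall>e>0. \<forall>\<^sub>F y in at x. ereal (- e) \<le> q y"
    proof (intro allI impI)
      fix e :: real assume "e > 0"
      then have "\<forall>\<^sub>F y in at x. ereal (- e) < q y"
        by (intro *[rule_format]) (simp add: zero_ereal_def)
      then show "\<forall>\<^sub>F y in at x. ereal (- e) \<le> q y"
        by (rule eventually_mono) simp
    qed
  next
    assume *: "\<forall>e>0. \<forall>\<^sub>F y in at x. ereal (- e) \<le> q y"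
    show "0 \<le> Liminf (at x) q"
      unfolding le_Liminf_iff
    proof (intro allI impI)
      fix c :: ereal assume "c < 0"
      then obtain e where e: "c < ereal e" "ereal e < 0"
        using ereal_dense2 by blast
      then have "\<forall>\<^sub>F y in at x. ereal (- (- e)) \<le> q y"
        by (intro *[rule_format]) simp
      then show "\<forall>\<^sub>F y in at x. c < q y"
        by (rule eventually_mono) (use e in auto)
    qed
  qed
  also have "\<dots> \<longleftrightarrow> ?R"
    by (intro all_cong1 imp_cong refl eventually_cong[OF ne]) (rule q_le)
  finally show ?thesis
    by (simp add: frechet_subdiff_def assms q_def[abs_def])
qed

section \<open>The scalar function \<open>\<bar>t\<bar> powr p\<close> and its slopes\<close>

definition powr_deriv :: "real \<Rightarrow> real \<Rightarrow> real" where
  "powr_deriv p t = p * sgn t * \<bar>t\<bar> powr (p - 1)"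

lemma abs_powr_has_derivative:
  assumes "t \<noteq> 0"
  shows "((\<lambda>t. \<bar>t\<bar> powr p) has_real_derivative powr_deriv p t) (at t)"
proof -
  have *: "((\<lambda>t. \<bar>t\<bar> powr p) has_real_derivative p * \<bar>t\<bar> powr (p - 1) * sgn t) (at t)"
  proof (rule DERIV_chain2[where f = "\<lambda>t. t powr p"])
    show "((\<lambda>t. t powr p) has_real_derivative p * \<bar>t\<bar> powr (p - 1)) (at \<bar>t\<bar>)"
      using assms by (intro has_real_derivative_powr) simp
    show "(abs has_real_derivative sgn t) (at t)"
      using GDERIV_norm[OF assms] by (simp add: fun_eq_iff[symmetric] real_norm_def[abs_def])
  qed
  then show ?thesis by (simp add: powr_deriv_def mult_ac)
qed

lemma continuous_powr_deriv:
  assumes "t \<noteq> 0"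
  shows "isCont (powr_deriv p) t"
  unfolding powr_deriv_def
  using assms by (intro continuous_intros) auto

text \<open>Since \<open>1 - p > 0\<close>, the factor
  \<open>\<bar>c\<bar> * \<bar>t\<bar> powr (1 - p)\<close> is at most 1 near 0, and its product
  with \<open>\<bar>t\<bar> powr p\<close> is \<open>\<bar>c * t\<bar>\<close>. The radius
  \<open>r\<close> is where this factor equals 1.\<close>

lemma abs_powr_superlinear_at_0:
  fixes p c :: real
  assumes "0 < p" "p < 1"
  shows "\<forall>\<^sub>F t in nhds 0. c * t \<le> \<bar>t\<bar> powr p"
proof (cases "c = 0")
  case False
  define r where "r = (1 / \<bar>c\<bar>) powr (1 / (1 - p))"
  have r: "r > 0" using False by (simp add: r_def)
  have "c * t \<le> \<bar>t\<bar> powr p" if "\<bar>t\<bar> < r" for t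
  proof (cases "t = 0")
    case False
    have "\<bar>t\<bar> powr (1 - p) \<le> r powr (1 - p)"
      using that assms by (intro powr_mono2) auto
    also have "r powr (1 - p) = 1 / \<bar>c\<bar>"
      using assms \<open>c \<noteq> 0\<close> by (simp add: r_def powr_powr)
    finally have le: "\<bar>c\<bar> * \<bar>t\<bar> powr (1 - p) \<le> 1"
      using \<open>c \<noteq> 0\<close> by (simp add: field_simps)
    have "c * t \<le> \<bar>c\<bar> * \<bar>t\<bar>"
      by (metis abs_ge_self abs_mult)
    also have "\<bar>t\<bar> = \<bar>t\<bar> powr (1 - p) * \<bar>t\<bar> powr p"
      using False by (simp flip: powr_add)
    also have "\<bar>c\<bar> * (\<bar>t\<bar> powr (1 - p) * \<bar>t\<bar> powr p) \<le> 1 * \<bar>t\<bar> powr p"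
      unfolding mult.assoc[symmetric] using le by (intro mult_right_mono) auto
    finally show ?thesis by simp
  qed simp
  then show ?thesis
    unfolding eventually_nhds_metric using r by (auto simp: dist_real_def)
qed simp

text \<open>The slope \<open>c\<close> is left free at \<open>t = 0\<close>, where the cusp
  dominates every linear function; elsewhere this is the first-order expansion with error
  \<open>e\<close>.\<close>

lemma abs_powr_subgradient:
  fixes p t c e :: real
  assumes "0 < p" "p < 1" "e > 0" "t \<noteq> 0 \<Longrightarrow> c = powr_deriv p t"
  shows "\<forall>\<^sub>F s in nhds t. \<bar>t\<bar> powr p + c * (s - t) - e * \<bar>s - t\<bar> \<le> \<bar>s\<bar> powr p"
proof (cases "t = 0")
  case True
  have "\<forall>\<^sub>F s in nhds 0. c * s \<le> \<bar>s\<bar> powr p"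
    by (rule abs_powr_superlinear_at_0[OF assms(1,2)])
  then show ?thesis
    unfolding True
  proof (rule eventually_mono)
    fix s assume "c * s \<le> \<bar>s\<bar> powr p"
    moreover have "0 \<le> e * \<bar>s\<bar>" using assms by simp
    ultimately show "\<bar>0\<bar> powr p + c * (s - 0) - e * \<bar>s - 0\<bar> \<le> \<bar>s\<bar> powr p"
      by simp
  qed
next
  case False
  have "((\<lambda>t. \<bar>t\<bar> powr p) has_derivative (*) c) (at t)"
    using abs_powr_has_derivative[OF False] assms(4)[OF False]
    by (simp add: has_field_derivative_def)
  then obtain d where d: "d > 0"
    "\<And>s. norm (s - t) < d \<Longrightarrow> norm (\<bar>s\<bar> powr p - \<bar>t\<bar> powr p - c * (s - t)) \<le> e * norm (s - t)"
    using assms(3) unfolding has_derivative_at_alt by blast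
  show ?thesis
    unfolding eventually_nhds_metric
    by (intro exI[of _ d] conjI d allI impI) (use d(2) in \<open>fastforce simp: dist_real_def abs_le_iff\<close>)
qed

text \<open>Both the Frechet and the limiting subdifferential of \<open>lp_pow p\<close> at \<open>x\<close>.\<close>

definition lp_subdiff :: "real \<Rightarrow> real ^ 'n \<Rightarrow> (real ^ 'n) set" where
  "lp_subdiff p x = {d. \<forall>i. x $ i \<noteq> 0 \<longrightarrow> d $ i = powr_deriv p (x $ i)}"

text \<open>By separability the scalar inequalities add up. The inequality itself is recorded
  because \<open>stationary_pointI\<close> later adds the one defining the normal cone to
  it.\<close>

lemma lp_subdiff_ineq:
  fixes x d :: "real ^ 'n"
  assumes p: "0 < p" "p < 1" and d: "d \<in> lp_subdiff p x" and "e > 0"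
  shows "\<forall>\<^sub>F y in at x. lp_pow p x + d \<bullet> (y - x) - e * norm (y - x) \<le> lp_pow p y"
proof -
  \<comment> \<open>The slack is shared evenly: each of the \<open>CARD('n)\<close> coordinates of
    \<open>y - x\<close> is bounded by its norm, so the total error is at most
    \<open>e * norm (y - x)\<close>.\<close>
  let ?e = "e / CARD('n)"
  have e: "?e > 0" using \<open>e > 0\<close> by simp
  have "\<forall>\<^sub>F y in at x. \<forall>i. \<bar>x $ i\<bar> powr p + d $ i * (y $ i - x $ i) - ?e * \<bar>y $ i - x $ i\<bar>
      \<le> \<bar>y $ i\<bar> powr p"
  proof (rule eventually_all_finite)
    fix i
    have "((\<lambda>y. y $ i) \<longlongrightarrow> x $ i) (at x)"
      by (intro tendsto_intros)
    moreover have "\<forall>\<^sub>F s in nhds (x $ i). \<bar>x $ i\<bar> powr p + d $ i * (s - x $ i) - ?e * \<bar>s - x $ i\<bar>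
        \<le> \<bar>s\<bar> powr p"
      using d by (intro abs_powr_subgradient p e) (auto simp: lp_subdiff_def)
    ultimately show "\<forall>\<^sub>F y in at x. \<bar>x $ i\<bar> powr p + d $ i * (y $ i - x $ i)
        - ?e * \<bar>y $ i - x $ i\<bar> \<le> \<bar>y $ i\<bar> powr p"
      by (rule eventually_compose_filterlim[rotated])
  qed
  then show ?thesis
  proof (rule eventually_mono)
    fix y
    assume *: "\<forall>i. \<bar>x $ i\<bar> powr p + d $ i * (y $ i - x $ i) - ?e * \<bar>y $ i - x $ i\<bar>
      \<le> \<bar>y $ i\<bar> powr p"
    have "(\<Sum>i\<in>UNIV. ?e * \<bar>y $ i - x $ i\<bar>) \<le> (\<Sum>i\<in>(UNIV::'n set). ?e * norm (y - x))"
      using e component_le_norm_cart[of "y - x"] by (intro sum_mono mult_left_mono) auto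
    also have "\<dots> = e * norm (y - x)" by simp
    finally have le: "(\<Sum>i\<in>UNIV. ?e * \<bar>y $ i - x $ i\<bar>) \<le> e * norm (y - x)" .
    have "(\<Sum>i\<in>UNIV. \<bar>x $ i\<bar> powr p + d $ i * (y $ i - x $ i) - ?e * \<bar>y $ i - x $ i\<bar>) \<le> lp_pow p y"
      unfolding lp_pow_def using * by (intro sum_mono) auto
    with le show "lp_pow p x + d \<bullet> (y - x) - e * norm (y - x) \<le> lp_pow p y"
      by (simp add: lp_pow_def inner_vec_def sum.distrib sum_subtractf)
  qed
qed

text \<open>The inclusion from left to right tests the minorant along the axis of a nonzero
  coordinate, where all other terms cancel. Dividing by the increment, positive steps bound
  \<open>d $ i\<close> above by the derivative and negative steps bound it below.\<close>

lemma frechet_subdiff_lp_pow: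
  fixes x :: "real ^ 'n"
  assumes p: "0 < p" "p < 1"
  shows "frechet_subdiff (\<lambda>y. ereal (lp_pow p y)) x = lp_subdiff p x"
proof (intro set_eqI iffI)
  fix d assume "d \<in> lp_subdiff p x"
  then show "d \<in> frechet_subdiff (\<lambda>y. ereal (lp_pow p y)) x"
    unfolding frechet_subdiff_iff[OF refl] ereal_less_eq
    by (intro allI impI) (rule lp_subdiff_ineq[OF p])
next
  fix d assume d: "d \<in> frechet_subdiff (\<lambda>y. ereal (lp_pow p y)) x"
  show "d \<in> lp_subdiff p x"
    unfolding lp_subdiff_def
  proof (intro CollectI allI impI)
    fix i assume xi: "x $ i \<noteq> 0"
    define D where "D = powr_deriv p (x $ i)"
    define Q where "Q h = (\<bar>x $ i + h\<bar> powr p - \<bar>x $ i\<bar> powr p) / h" for h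
    have lim: "(Q \<longlongrightarrow> D) (at 0)"
      using abs_powr_has_derivative[OF xi, of p]
      unfolding DERIV_def Q_def D_def by simp
    have axis_scaleR: "h *\<^sub>R axis i 1 = (axis i h :: real ^ 'n)" for h :: real
      by (simp add: axis_def vec_eq_iff)
    have axis_0: "axis i 0 = (0 :: real ^ 'n)"
      by (simp add: axis_def vec_eq_iff)
    have norm_axis': "norm (axis i h :: real ^ 'n) = \<bar>h\<bar>" for h :: real
      unfolding axis_scaleR[symmetric, of h] by simp
    have ev: "\<forall>\<^sub>F h in at 0. \<bar>x $ i\<bar> powr p + d $ i * h - e * \<bar>h\<bar> \<le> \<bar>x $ i + h\<bar> powr p"
      if "e > 0" for e
    proof -
      have "\<forall>\<^sub>F y in at x. lp_pow p x + d \<bullet> (y - x) - e * norm (y - x) \<le> lp_pow p y"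
        using d that by (simp add: frechet_subdiff_iff[OF refl])
      moreover have "filterlim (\<lambda>h::real. x + axis i h) (at x) (at 0)"
      proof (rule filterlim_atI)
        have "((\<lambda>h::real. x + h *\<^sub>R axis i 1) \<longlongrightarrow> x + 0 *\<^sub>R axis i 1) (at 0)"
          by (intro tendsto_intros)
        then show "((\<lambda>h::real. x + axis i h) \<longlongrightarrow> x) (at 0)" by (simp add: axis_scaleR axis_0)
        show "\<forall>\<^sub>F h in at 0. x + axis i h \<noteq> x"
          by (simp add: eventually_at_filter axis_eq_0_iff)
      qed
      ultimately have "\<forall>\<^sub>F h in at 0. lp_pow p x + d \<bullet> (x + axis i h - x) - e * norm (x + axis i h - x)
          \<le> lp_pow p (x + axis i h)"
        by (rule eventually_compose_filterlim)
      then show ?thesis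
      proof (rule eventually_mono)
        fix h
        have "lp_pow p (x + axis i h) = (\<Sum>j\<in>UNIV. \<bar>x $ j\<bar> powr p
            + (if j = i then \<bar>x $ i + h\<bar> powr p - \<bar>x $ i\<bar> powr p else 0))"
          unfolding lp_pow_def by (intro sum.cong) (auto simp: axis_def)
        also have "\<dots> = lp_pow p x + \<bar>x $ i + h\<bar> powr p - \<bar>x $ i\<bar> powr p"
          by (simp add: sum.distrib lp_pow_def)
        finally show "lp_pow p x + d \<bullet> (x + axis i h - x) - e * norm (x + axis i h - x)
          \<le> lp_pow p (x + axis i h) \<Longrightarrow>
          \<bar>x $ i\<bar> powr p + d $ i * h - e * \<bar>h\<bar> \<le> \<bar>x $ i + h\<bar> powr p"
          by (simp add: inner_axis norm_axis')
      qed
    qed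
    have le: "d $ i \<le> D"
    proof (rule field_le_epsilon)
      fix e :: real assume "e > 0"
      have "\<forall>\<^sub>F h in at_right 0. d $ i - e \<le> Q h"
        using ev[OF \<open>e > 0\<close>] unfolding eventually_at_filter
      proof (rule eventually_mono, intro impI)
        fix h assume h: "h \<in> {0<..}" "h \<noteq> 0 \<longrightarrow> h \<in> UNIV \<longrightarrow>
            \<bar>x $ i\<bar> powr p + d $ i * h - e * \<bar>h\<bar> \<le> \<bar>x $ i + h\<bar> powr p"
        then have "(d $ i - e) * h \<le> \<bar>x $ i + h\<bar> powr p - \<bar>x $ i\<bar> powr p"
          by (simp add: algebra_simps)
        with h(1) show "d $ i - e \<le> Q h"
          by (simp add: Q_def pos_le_divide_eq)
      qed
      with lim have "d $ i - e \<le> D"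
        by (intro tendsto_lowerbound[of Q]) (auto intro: filterlim_at_split[THEN iffD1, THEN conjunct2])
      then show "d $ i \<le> D + e" by simp
    qed
    have ge: "D \<le> d $ i"
    proof (rule field_le_epsilon)
      fix e :: real assume "e > 0"
      have "\<forall>\<^sub>F h in at_left 0. Q h \<le> d $ i + e"
        using ev[OF \<open>e > 0\<close>] unfolding eventually_at_filter
      proof (rule eventually_mono, intro impI)
        fix h assume h: "h \<in> {..<0}" "h \<noteq> 0 \<longrightarrow> h \<in> UNIV \<longrightarrow>
            \<bar>x $ i\<bar> powr p + d $ i * h - e * \<bar>h\<bar> \<le> \<bar>x $ i + h\<bar> powr p"
        then have "(d $ i + e) * h \<le> \<bar>x $ i + h\<bar> powr p - \<bar>x $ i\<bar> powr p"
          by (simp add: algebra_simps)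
        with h(1) show "Q h \<le> d $ i + e"
          by (simp add: Q_def neg_divide_le_eq)
      qed
      with lim show "D \<le> d $ i + e"
        by (intro tendsto_upperbound[of Q]) (auto intro: filterlim_at_split[THEN iffD1, THEN conjunct1])
    qed
    from le ge show "d $ i = powr_deriv p (x $ i)" by (simp add: D_def)
  qed
qed

text \<open>Nonzero coordinates of \<open>x\<close> stay nonzero along the approximating sequence,
  and \<open>powr_deriv p\<close> is continuous there, so the prescribed components pass to the
  limit.\<close>

lemma limiting_subdiff_lp_pow_subset:
  assumes p: "0 < p" "p < 1"
  shows "limiting_subdiff (\<lambda>y. ereal (lp_pow p y)) x \<subseteq> lp_subdiff p x"
proof
  fix d assume "d \<in> limiting_subdiff (\<lambda>y. ereal (lp_pow p y)) x"
  then obtain X D where X: "X \<longlonglongrightarrow> x" and D: "D \<longlonglongrightarrow> d" "\<And>k. D k \<in> lp_subdiff p (X k)"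
    unfolding limiting_subdiff_def frechet_subdiff_lp_pow[OF p] by auto
  show "d \<in> lp_subdiff p x"
    unfolding lp_subdiff_def
  proof (intro CollectI allI impI)
    fix i assume xi: "x $ i \<noteq> 0"
    have Xi: "(\<lambda>k. X k $ i) \<longlonglongrightarrow> x $ i"
      using X by (intro tendsto_intros)
    have "(\<lambda>k. powr_deriv p (X k $ i)) \<longlonglongrightarrow> powr_deriv p (x $ i)"
      by (rule isCont_tendsto_compose[OF continuous_powr_deriv[OF xi] Xi])
    moreover have "\<forall>\<^sub>F k in sequentially. powr_deriv p (X k $ i) = D k $ i"
      using tendsto_imp_eventually_ne[OF Xi xi]
      by (rule eventually_mono) (use D(2) in \<open>auto simp: lp_subdiff_def\<close>)
    ultimately have "(\<lambda>k. D k $ i) \<longlonglongrightarrow> powr_deriv p (x $ i)"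
      by (rule Lim_transform_eventually)
    moreover have "(\<lambda>k. D k $ i) \<longlonglongrightarrow> d $ i"
      using D(1) by (intro tendsto_intros)
    ultimately show "d $ i = powr_deriv p (x $ i)"
      using LIMSEQ_unique by blast
  qed
qed

text \<open>Components off the support of \<open>x\<close> are unrestricted, so they may grow
  without bound at the fixed point \<open>x\<close>: in \<open>D k\<close> the direction
  \<open>d\<close> is stretched by \<open>1 + k\<close>, and scaling back by \<open>t k\<close>
  preserves \<open>d\<close> while erasing the base subgradient \<open>s\<close>.\<close>

lemma horizon_subdiff_lp_pow_superset:
  assumes p: "0 < p" "p < 1" and d: "\<And>i. x $ i \<noteq> 0 \<Longrightarrow> d $ i = 0"
  shows "d \<in> horizon_subdiff (\<lambda>y. ereal (lp_pow p y)) x"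
proof -
  define s where "s = (\<chi> i. powr_deriv p (x $ i))"
  define t where "t k = 1 / (1 + real k)" for k
  define D where "D k = s + (1 + real k) *\<^sub>R d" for k
  have "t k *\<^sub>R D k = t k *\<^sub>R s + d" for k
    by (simp add: D_def t_def scaleR_add_right)
  moreover have t: "t \<longlonglongrightarrow> 0"
    unfolding t_def using LIMSEQ_inverse_real_of_nat by (simp add: inverse_eq_divide add.commute)
  then have "(\<lambda>k. t k *\<^sub>R s + d) \<longlonglongrightarrow> 0 *\<^sub>R s + d"
    by (intro tendsto_intros)
  ultimately have "(\<lambda>k. t k *\<^sub>R D k) \<longlonglongrightarrow> d" by simp
  moreover have "D k \<in> lp_subdiff p x" for k
    using d by (simp add: lp_subdiff_def D_def s_def)
  moreover have "t k > 0" for k by (simp add: t_def add_pos_nonneg)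
  moreover have "decseq t"
    by (auto simp: decseq_def t_def frac_le)
  ultimately show ?thesis
    unfolding horizon_subdiff_def frechet_subdiff_lp_pow[OF p] mem_Collect_eq
    using t by (intro conjI exI[of _ "\<lambda>_. x"] exI[of _ D] exI[of _ t]) auto
qed

section \<open>The smoothed penalty term\<close>

definition h_deriv :: "real \<Rightarrow> real \<Rightarrow> real" where
  "h_deriv \<nu> t = (if \<bar>t\<bar> \<ge> \<nu> / 2 then sgn t else 2 * t / \<nu>)"

text \<open>Squaring removes the kink at 0: the difference quotient there is bounded by the absolute
  value of the increment.\<close>

lemma has_real_derivative_max_0_squared:
  fixes s :: real
  shows "((\<lambda>s. (max s 0)\<^sup>2) has_real_derivative 2 * max s 0) (at s)"
proof -
  consider "s < 0" | "s = 0" | "s > 0" by linarith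
  then show ?thesis
  proof cases
    case 1
    have "((\<lambda>s. 0) has_real_derivative 2 * max s 0) (at s)"
      using 1 by simp
    then show ?thesis
      by (rule has_field_derivative_transform_within_open[where S = "{..<0}"]) (use 1 in auto)
  next
    case 2
    have "(\<lambda>h::real. (max h 0)\<^sup>2 / h) \<midarrow>0\<rightarrow> 0"
    proof (rule Lim_null_comparison)
      show "\<forall>\<^sub>F h in at 0. norm ((max h 0)\<^sup>2 / h) \<le> \<bar>h::real\<bar>"
        by (rule always_eventually) (auto simp: max_def power2_eq_square)
      show "((\<lambda>h::real. \<bar>h\<bar>) \<longlongrightarrow> 0) (at 0)"
        using tendsto_rabs[OF tendsto_ident_at, of 0 UNIV] by simp
    qed
    then show ?thesis
      using 2 by (simp add: DERIV_def)
  next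
    case 3
    have "((\<lambda>s. s\<^sup>2) has_real_derivative 2 * max s 0) (at s)"
      using 3 by (auto intro!: derivative_eq_intros)
    then show ?thesis
      by (rule has_field_derivative_transform_within_open[where S = "{0<..}"]) (use 3 in auto)
  qed
qed

text \<open>The correction terms are continuously differentiable, so that no case distinction at the
  breakpoints of \<open>h_smooth\<close> is needed in order to differentiate it.\<close>

lemma h_smooth_alt:
  assumes "\<nu> > 0"
  shows "h_smooth \<nu> t =
    t\<^sup>2 / \<nu> + \<nu> / 4 - ((max (t - \<nu> / 2) 0)\<^sup>2 + (max (- t - \<nu> / 2) 0)\<^sup>2) / \<nu>"
proof -
  consider "t \<ge> \<nu> / 2" | "- t \<ge> \<nu> / 2" | "\<bar>t\<bar> < \<nu> / 2" by linarith
  then show ?thesis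
  proof cases
    case 1
    then have "\<bar>t\<bar> = t" "max (t - \<nu> / 2) 0 = t - \<nu> / 2" "max (- t - \<nu> / 2) 0 = 0"
      using assms by auto
    then show ?thesis
      using 1 assms by (simp add: h_smooth_def field_simps power2_eq_square)
  next
    case 2
    then have "\<bar>t\<bar> = - t" "max (t - \<nu> / 2) 0 = 0" "max (- t - \<nu> / 2) 0 = - t - \<nu> / 2"
      using assms by auto
    then show ?thesis
      using 2 assms by (simp add: h_smooth_def field_simps power2_eq_square)
  next
    case 3
    then have "max (t - \<nu> / 2) 0 = 0" "max (- t - \<nu> / 2) 0 = 0"
      by auto
    then show ?thesis
      using 3 by (simp add: h_smooth_def)
  qed
qed

lemma h_smooth_has_derivative:
  assumes "\<nu> > 0"
  shows "(h_smooth \<nu> has_real_derivative h_deriv \<nu> t) (at t)"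
proof -
  have D1: "((\<lambda>t. (max (t - \<nu> / 2) 0)\<^sup>2) has_real_derivative 2 * max (t - \<nu> / 2) 0 * 1) (at t)"
    by (rule DERIV_chain2[OF has_real_derivative_max_0_squared]) (auto intro!: derivative_eq_intros)
  have D2: "((\<lambda>t. (max (- t - \<nu> / 2) 0)\<^sup>2) has_real_derivative
      2 * max (- t - \<nu> / 2) 0 * (- 1)) (at t)"
    by (rule DERIV_chain2[OF has_real_derivative_max_0_squared]) (auto intro!: derivative_eq_intros)
  have D0: "((\<lambda>t. t\<^sup>2) has_real_derivative 2 * t) (at t)"
    by (auto intro!: derivative_eq_intros)
  have "((\<lambda>t. t\<^sup>2 / \<nu> + \<nu> / 4 - ((max (t - \<nu> / 2) 0)\<^sup>2 + (max (- t - \<nu> / 2) 0)\<^sup>2) / \<nu>)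
      has_real_derivative 2 * t / \<nu> + 0 -
        (2 * max (t - \<nu> / 2) 0 * 1 + 2 * max (- t - \<nu> / 2) 0 * (- 1)) / \<nu>) (at t)"
    by (intro DERIV_diff DERIV_add DERIV_cdivide DERIV_const D0 D1 D2)
  then have "(h_smooth \<nu> has_real_derivative
      2 * t / \<nu> - (2 * max (t - \<nu> / 2) 0 - 2 * max (- t - \<nu> / 2) 0) / \<nu>) (at t)"
    by (simp add: h_smooth_alt[OF assms, abs_def])
  also have "2 * t / \<nu> - (2 * max (t - \<nu> / 2) 0 - 2 * max (- t - \<nu> / 2) 0) / \<nu> = h_deriv \<nu> t"
  proof -
    consider "t \<ge> \<nu> / 2" | "- t \<ge> \<nu> / 2" | "\<bar>t\<bar> < \<nu> / 2" by linarith
    then show ?thesis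
    proof cases
      case 1
      then have "max (t - \<nu> / 2) 0 = t - \<nu> / 2" "max (- t - \<nu> / 2) 0 = 0" "sgn t = 1" "\<bar>t\<bar> = t"
        using assms by auto
      then show ?thesis
        using 1 assms by (simp add: h_deriv_def field_simps)
    next
      case 2
      then have "max (t - \<nu> / 2) 0 = 0" "max (- t - \<nu> / 2) 0 = - t - \<nu> / 2" "sgn t = - 1" "\<bar>t\<bar> = - t"
        using assms by auto
      then show ?thesis
        using 2 assms by (simp add: h_deriv_def field_simps)
    next
      case 3
      then have "max (t - \<nu> / 2) 0 = 0" "max (- t - \<nu> / 2) 0 = 0"
        by auto
      then show ?thesis
        using 3 by (simp add: h_deriv_def)
    qed
  qed
  finally show ?thesis .
qed

lemma abs_h_deriv_le: "\<nu> > 0 \<Longrightarrow> \<bar>h_deriv \<nu> t\<bar> \<le> 1"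
  by (simp add: h_deriv_def sgn_real_def field_simps abs_mult)

text \<open>The quadratic branch minus \<open>\<bar>t\<bar>\<close> is the square
  \<open>(\<bar>t\<bar> - \<nu> / 2)\<^sup>2 / \<nu>\<close>, which gives the lower bound; the upper
  one follows from \<open>t\<^sup>2 \<le> \<nu> * \<bar>t\<bar>\<close> on that branch.\<close>

lemma h_smooth_bounds:
  assumes "\<nu> > 0"
  shows "\<bar>t\<bar> \<le> h_smooth \<nu> t" and "h_smooth \<nu> t \<le> \<bar>t\<bar> + \<nu> / 4"
proof -
  have "0 \<le> (\<bar>t\<bar> - \<nu> / 2)\<^sup>2 / \<nu>"
    using assms by simp
  also have "\<dots> = t\<^sup>2 / \<nu> + \<nu> / 4 - \<bar>t\<bar>"
    using assms by (simp add: power2_diff power_divide diff_divide_distrib add_divide_distrib)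
      (simp add: power2_eq_square)
  finally show "\<bar>t\<bar> \<le> h_smooth \<nu> t"
    by (simp add: h_smooth_def)
  have "t\<^sup>2 \<le> \<nu> * \<bar>t\<bar>" if "\<bar>t\<bar> < \<nu> / 2"
    using that mult_right_mono[of "\<bar>t\<bar>" \<nu> "\<bar>t\<bar>"] assms by (simp add: power2_eq_square)
  then show "h_smooth \<nu> t \<le> \<bar>t\<bar> + \<nu> / 4"
    using assms by (auto simp: h_smooth_def field_simps)
qed

text \<open>The smoothing respects the identity \<open>max s 0 = (s + \<bar>s\<bar>) / 2\<close>, so
  bounds and derivatives of \<open>g_smooth\<close> are inherited from
  \<open>h_smooth\<close>.\<close>

lemma g_smooth_eq_h_smooth: "\<mu> > 0 \<Longrightarrow> g_smooth \<mu> s = (s + h_smooth \<mu> s) / 2"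
  by (auto simp: g_smooth_def h_smooth_def field_simps)

lemma g_smooth_has_derivative:
  assumes "\<mu> > 0"
  shows "(g_smooth \<mu> has_real_derivative (1 + h_deriv \<mu> s) / 2) (at s)"
  unfolding g_smooth_eq_h_smooth[OF assms, abs_def]
  by (intro DERIV_cdivide DERIV_add DERIV_ident h_smooth_has_derivative assms)

section \<open>Smoothing errors of the penalty\<close>

lemma H_smooth_bounds:
  fixes z :: "real ^ 'm"
  assumes "\<nu> > 0"
  shows "l1_norm z \<le> H_smooth \<nu> z" and "H_smooth \<nu> z \<le> l1_norm z + real CARD('m) * \<nu> / 4"
proof -
  show "l1_norm z \<le> H_smooth \<nu> z"
    unfolding l1_norm_def H_smooth_def by (intro sum_mono h_smooth_bounds assms)
  have "H_smooth \<nu> z \<le> (\<Sum>i\<in>UNIV. \<bar>z $ i\<bar> + \<nu> / 4)"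
    unfolding H_smooth_def by (intro sum_mono h_smooth_bounds assms)
  then show "H_smooth \<nu> z \<le> l1_norm z + real CARD('m) * \<nu> / 4"
    by (simp add: sum.distrib l1_norm_def)
qed

text \<open>Both smoothings lie above the functions they replace, so a bound on the penalized
  objective controls the true constraint violation.\<close>

lemma f_penalty_lower:
  assumes "lam > 0" "\<mu> > 0" "\<nu> > 0"
  shows "lam * max (l1_norm (A *v x - b) - \<sigma>) 0 \<le> f_penalty A b \<sigma> lam \<mu> \<nu> x"
proof -
  have "max (l1_norm (A *v x - b) - \<sigma>) 0 \<le> g_smooth \<mu> (H_smooth \<nu> (A *v x - b) - \<sigma>)"
    using H_smooth_bounds(1)[OF assms(3), of "A *v x - b"]
      h_smooth_bounds(1)[OF assms(2), of "H_smooth \<nu> (A *v x - b) - \<sigma>"]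
    unfolding g_smooth_eq_h_smooth[OF assms(2)] by (intro max.boundedI) argo+
  then show ?thesis
    using assms by (simp add: f_penalty_def)
qed

text \<open>At a feasible point only the smoothing errors remain: \<open>\<nu> / 4\<close> for each
  residual and \<open>\<mu> / 8\<close> for the positive part. They are grouped into the products
  \<open>lam * \<nu>\<close> and \<open>lam * \<mu>\<close>, which stay bounded along the
  algorithm.\<close>

lemma f_penalty_upper_feasible:
  fixes A :: "real ^ 'n ^ 'm"
  assumes "lam > 0" "\<mu> > 0" "\<nu> > 0" "x \<in> feasible_set A b \<sigma>"
  shows "f_penalty A b \<sigma> lam \<mu> \<nu> x \<le> real CARD('m) * (lam * \<nu>) / 4 + lam * \<mu> / 8"
proof -
  have pos: "0 \<le> real CARD('m) * \<nu>" using assms by simp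
  have "g_smooth \<mu> (H_smooth \<nu> (A *v x - b) - \<sigma>) \<le> real CARD('m) * \<nu> / 4 + \<mu> / 8"
    using H_smooth_bounds(2)[OF assms(3), of "A *v x - b"] assms(4) pos
      h_smooth_bounds(2)[OF assms(2), of "H_smooth \<nu> (A *v x - b) - \<sigma>"]
    unfolding g_smooth_eq_h_smooth[OF assms(2)] feasible_set_def mem_Collect_eq by argo
  then have "lam * g_smooth \<mu> (H_smooth \<nu> (A *v x - b) - \<sigma>) \<le> lam * (real CARD('m) * \<nu> / 4 + \<mu> / 8)"
    using assms by simp
  then show ?thesis
    by (simp add: f_penalty_def algebra_simps)
qed

section \<open>Gradient of the penalty\<close>

lemma gradient_eqI:
  assumes "GDERIV f x :> d"
  shows "gradient f x = d"
  unfolding gradient_def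
proof (rule the_equality, rule assms)
  fix d' assume "GDERIV f x :> d'"
  then have "(\<lambda>h. h \<bullet> d') = (\<lambda>h. h \<bullet> d)"
    using assms unfolding gderiv_def by (rule has_derivative_unique)
  then show "d' = d"
    by (metis vector_eq_ldot)
qed

text \<open>This is the chain rule, arranged as a scalar times \<open>s v* A\<close>, the transpose
  of \<open>A\<close> applied to \<open>s\<close>. For \<open>lam > 0\<close> the scalar is
  nonnegative, which is the shape needed for normal vectors.\<close>

lemma gradient_f_penalty:
  fixes A :: "real ^ 'n ^ 'm"
  assumes "\<mu> > 0" "\<nu> > 0"
  shows "gradient (f_penalty A b \<sigma> lam \<mu> \<nu>) x =
    (lam * ((1 + h_deriv \<mu> (H_smooth \<nu> (A *v x - b) - \<sigma>)) / 2)) *\<^sub>R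
      ((\<chi> i. h_deriv \<nu> ((A *v x - b) $ i)) v* A)"
proof (rule gradient_eqI)
  define s where "s = (\<chi> i. h_deriv \<nu> ((A *v x - b) $ i))"
  have "((\<lambda>x. H_smooth \<nu> (A *v x - b) - \<sigma>) has_derivative
      (\<lambda>h. \<Sum>i\<in>UNIV. (A *v h) $ i * s $ i)) (at x)"
    unfolding H_smooth_def
  proof (rule has_derivative_diff[where g' = "\<lambda>_. 0", simplified], rule has_derivative_sum)
    fix i
    have "((\<lambda>x. (A *v x - b) $ i) has_derivative (\<lambda>h. (A *v h) $ i)) (at x)"
      by (auto intro!: derivative_eq_intros
          bounded_linear.has_derivative[OF bounded_linear_vec_nth]
          bounded_linear.has_derivative[OF matrix_vector_mul_bounded_linear])
    then have "((\<lambda>x. h_smooth \<nu> ((A *v x - b) $ i)) has_derivative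
        (\<lambda>h. (A *v h) $ i * h_deriv \<nu> ((A *v x - b) $ i))) (at x)"
      using h_smooth_has_derivative[OF assms(2), of "(A *v x - b) $ i"]
      by (rule DERIV_compose_FDERIV[rotated])
    then show "((\<lambda>x. h_smooth \<nu> ((A *v x - b) $ i)) has_derivative (\<lambda>h. (A *v h) $ i * s $ i)) (at x)"
      by (simp add: s_def)
  qed simp
  also have "(\<lambda>h. \<Sum>i\<in>UNIV. (A *v h) $ i * s $ i) = (\<lambda>h. h \<bullet> (s v* A))"
    using dot_lmul_matrix[of s A] by (simp add: fun_eq_iff inner_vec_def inner_commute mult.commute)
  finally have "GDERIV (\<lambda>x. H_smooth \<nu> (A *v x - b) - \<sigma>) x :> s v* A"
    by (simp add: gderiv_def)
  from GDERIV_DERIV_compose[OF this DERIV_cmult[OF g_smooth_has_derivative[OF assms(1)], of lam]]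
  show "GDERIV (f_penalty A b \<sigma> lam \<mu> \<nu>) x :>
    (lam * ((1 + h_deriv \<mu> (H_smooth \<nu> (A *v x - b) - \<sigma>)) / 2)) *\<^sub>R
      ((\<chi> i. h_deriv \<nu> ((A *v x - b) $ i)) v* A)"
    by (simp add: f_penalty_def[abs_def] s_def)
qed

section \<open>Normal cone of the feasible set\<close>

lemma closed_normal_cone: "closed (normal_cone S x)"
proof (cases "x \<in> S")
  case True
  then have "normal_cone S x = (\<Inter>y\<in>S. {d. (y - x) \<bullet> d \<le> 0})"
    by (auto simp: normal_cone_def inner_commute)
  then show ?thesis
    by (simp add: closed_INT closed_halfspace_le)
qed (simp add: normal_cone_def)

lemma normal_cone_scaleR: "d \<in> normal_cone S x \<Longrightarrow> 0 \<le> c \<Longrightarrow> c *\<^sub>R d \<in> normal_cone S x"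
  by (auto simp: normal_cone_def mult_nonneg_nonpos)

text \<open>The vector \<open>s\<close> is a subgradient of the l1 norm at the residual of
  \<open>x\<close>: its inner product with that residual is \<open>\<sigma>\<close>, and with the
  residual of any feasible \<open>y\<close> it is at most \<open>\<sigma>\<close>.\<close>

lemma normal_cone_feasible_set:
  fixes A :: "real ^ 'n ^ 'm" and s :: "real ^ 'm"
  assumes "l1_norm (A *v x - b) = \<sigma>" "\<And>i. \<bar>s $ i\<bar> \<le> 1"
    and "\<And>i. s $ i * (A *v x - b) $ i = \<bar>(A *v x - b) $ i\<bar>"
  shows "s v* A \<in> normal_cone (feasible_set A b \<sigma>) x"
  unfolding normal_cone_def
proof (intro CollectI conjI ballI)
  show "x \<in> feasible_set A b \<sigma>"
    using assms(1) by (simp add: feasible_set_def)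
  fix y assume y: "y \<in> feasible_set A b \<sigma>"
  have "(s v* A) \<bullet> (y - x) = s \<bullet> (A *v y - b) - s \<bullet> (A *v x - b)"
    by (simp add: dot_lmul_matrix matrix_vector_mult_diff_distrib inner_diff_right)
  also have "s \<bullet> (A *v x - b) = \<sigma>"
    using assms(1,3) by (simp add: inner_vec_def l1_norm_def)
  also have "s \<bullet> (A *v y - b) \<le> l1_norm (A *v y - b)"
    unfolding inner_vec_def l1_norm_def
  proof (rule sum_mono)
    fix i
    have "s $ i \<bullet> (A *v y - b) $ i \<le> \<bar>s $ i\<bar> * \<bar>(A *v y - b) $ i\<bar>"
      by (metis abs_ge_self abs_mult inner_real_def)
    also have "\<dots> \<le> 1 * \<bar>(A *v y - b) $ i\<bar>"
      by (intro mult_right_mono assms(2)) simp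
    finally show "s $ i \<bullet> (A *v y - b) $ i \<le> \<bar>(A *v y - b) $ i\<bar>" by simp
  qed
  also have "l1_norm (A *v y - b) \<le> \<sigma>"
    using y by (simp add: feasible_set_def)
  finally show "(s v* A) \<bullet> (y - x) \<le> 0" by simp
qed

lemma tendsto_l1_norm_residual:
  assumes "(z \<longlongrightarrow> x) F"
  shows "((\<lambda>k. l1_norm (A *v z k - b)) \<longlongrightarrow> l1_norm (A *v x - b)) F"
proof -
  have "((\<lambda>k. A *v z k) \<longlongrightarrow> A *v x) F"
    by (rule bounded_linear.tendsto[OF matrix_vector_mul_bounded_linear assms])
  then show ?thesis
    unfolding l1_norm_def by (intro tendsto_intros)
qed

text \<open>The signs of the nonzero residuals have settled eventually, so that the gradients lie
  in the normal cone at the limit itself and not merely close to it.\<close>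

lemma gradient_f_penalty_eventually_normal:
  fixes A :: "real ^ 'n ^ 'm"
  assumes z: "z \<longlonglongrightarrow> x" and x: "x \<in> feasible_set A b \<sigma>"
    and pos: "\<And>k. lam k > 0" "\<And>k. \<mu> k > 0" "\<And>k. \<nu> k > 0"
    and lim: "\<mu> \<longlonglongrightarrow> 0" "\<nu> \<longlonglongrightarrow> 0"
  shows "\<forall>\<^sub>F k in sequentially.
    gradient (f_penalty A b \<sigma> (lam k) (\<mu> k) (\<nu> k)) (z k) \<in> normal_cone (feasible_set A b \<sigma>) x"
proof -
  define c where "c k = lam k * ((1 + h_deriv (\<mu> k) (H_smooth (\<nu> k) (A *v z k - b) - \<sigma>)) / 2)" for k
  define s where "s k = (\<chi> i. h_deriv (\<nu> k) ((A *v z k - b) $ i))" for k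
  have grad: "gradient (f_penalty A b \<sigma> (lam k) (\<mu> k) (\<nu> k)) (z k) = c k *\<^sub>R (s k v* A)" for k
    by (simp add: gradient_f_penalty[OF pos(2,3)] c_def s_def)
  have le: "l1_norm (A *v x - b) \<le> \<sigma>"
    using x by (simp add: feasible_set_def)
  show ?thesis
    unfolding grad
  proof (cases "l1_norm (A *v x - b) = \<sigma>")
    case True
    have c: "c k \<ge> 0" for k
      using pos(1)[of k] abs_h_deriv_le[OF pos(2), of k "H_smooth (\<nu> k) (A *v z k - b) - \<sigma>"]
      by (simp add: c_def abs_le_iff)
    have "\<forall>\<^sub>F k in sequentially. \<forall>i. s k $ i * (A *v x - b) $ i = \<bar>(A *v x - b) $ i\<bar>"
    proof (rule eventually_all_finite)
      fix i
      define r where "r = (A *v x - b) $ i"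
      define q where "q k = (A *v z k - b) $ i" for k
      have q: "q \<longlonglongrightarrow> r"
        unfolding q_def r_def
        by (intro tendsto_intros bounded_linear.tendsto[OF matrix_vector_mul_bounded_linear z])
      show "\<forall>\<^sub>F k in sequentially. s k $ i * (A *v x - b) $ i = \<bar>(A *v x - b) $ i\<bar>"
      proof (cases "r = 0")
        case False
        \<comment> \<open>Two conditions fix the sign: beyond the breakpoint
          \<open>\<nu> k / 2\<close> the value of \<open>h_deriv\<close> is
          \<open>sgn (q k)\<close>, and \<open>0 < q k * r\<close> identifies it with
          \<open>sgn r\<close>.\<close>
        have "(\<lambda>k. \<bar>q k\<bar> - \<nu> k / 2) \<longlonglongrightarrow> \<bar>r\<bar> - 0 / 2"
          by (intro tendsto_intros q lim) simp
        then have ev1: "\<forall>\<^sub>F k in sequentially. 0 < \<bar>q k\<bar> - \<nu> k / 2"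
          using False by (intro order_tendstoD(1)) auto
        have "(\<lambda>k. q k * r) \<longlonglongrightarrow> r * r"
          by (intro tendsto_intros q)
        moreover have "0 < r * r"
          using False by (metis not_real_square_gt_zero)
        ultimately have ev2: "\<forall>\<^sub>F k in sequentially. 0 < q k * r"
          by (rule order_tendstoD)
        from ev1 ev2 show ?thesis
        proof eventually_elim
          case (elim k)
          have "s k $ i = h_deriv (\<nu> k) (q k)"
            by (simp add: s_def q_def)
          with elim have "s k $ i = sgn r"
            by (auto simp: h_deriv_def sgn_real_def zero_less_mult_iff)
          then show ?case
            unfolding r_def[symmetric] by (simp add: abs_sgn mult.commute)
        qed
      qed (simp add: r_def)
    qed
    then show "\<forall>\<^sub>F k in sequentially. c k *\<^sub>R (s k v* A) \<in> normal_cone (feasible_set A b \<sigma>) x"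
      by (rule eventually_mono)
        (intro normal_cone_scaleR c normal_cone_feasible_set True;
          simp add: s_def abs_h_deriv_le pos)
  next
    case False
    \<comment> \<open>With an inactive constraint, the argument of \<open>g_smooth\<close>
      eventually drops below \<open>- \<mu> k / 2\<close>, where that function is flat. The gradient
      then vanishes, and 0 is normal at every feasible point.\<close>
    have "(\<lambda>k. l1_norm (A *v z k - b) + real CARD('m) * \<nu> k / 4 + \<mu> k / 2) \<longlonglongrightarrow>
        l1_norm (A *v x - b) + real CARD('m) * 0 / 4 + 0 / 2"
      by (intro tendsto_intros tendsto_l1_norm_residual z lim) simp_all
    then have "\<forall>\<^sub>F k in sequentially. l1_norm (A *v z k - b) + real CARD('m) * \<nu> k / 4 + \<mu> k / 2 < \<sigma>"
      using le False by (intro order_tendstoD) auto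
    then show "\<forall>\<^sub>F k in sequentially. c k *\<^sub>R (s k v* A) \<in> normal_cone (feasible_set A b \<sigma>) x"
    proof (rule eventually_mono)
      fix k assume "l1_norm (A *v z k - b) + real CARD('m) * \<nu> k / 4 + \<mu> k / 2 < \<sigma>"
      then have "H_smooth (\<nu> k) (A *v z k - b) - \<sigma> < - (\<mu> k / 2)"
        using H_smooth_bounds(2)[OF pos(3), of k "A *v z k - b"] by linarith
      then have "c k = 0"
        using pos(2)[of k] by (simp add: c_def h_deriv_def)
      then show "c k *\<^sub>R (s k v* A) \<in> normal_cone (feasible_set A b \<sigma>) x"
        using x by (simp add: normal_cone_def)
    qed
  qed
qed

section \<open>Stationarity and convergence\<close>

text \<open>Trivial intersection yields a bound \<open>\<delta> * norm v \<le> norm (v + l)\<close>.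
  Thus a convergent sequence of sums has bounded parts in \<open>N\<close>; a subsequence of them
  converges, and so do the corresponding parts in \<open>L\<close>.\<close>

lemma closed_sum_cone_subspace:
  fixes N L :: "'a::euclidean_space set"
  assumes N: "closed N" "\<And>v c. v \<in> N \<Longrightarrow> c \<ge> 0 \<Longrightarrow> c *\<^sub>R v \<in> N"
    and L: "subspace L" and NL: "N \<inter> L \<subseteq> {0}"
  shows "closed {v + l |v l. v \<in> N \<and> l \<in> L}"
proof -
  have clL: "closed L" using L by (rule closed_subspace)
  obtain \<delta> where \<delta>: "\<delta> > 0" "\<And>v l. v \<in> N \<Longrightarrow> l \<in> L \<Longrightarrow> \<delta> * norm v \<le> norm (v + l)"
  proof (cases "N \<inter> sphere 0 1 = {}")
    \<comment> \<open>Treated apart because \<open>setdist\<close> to the empty set is 0 and would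
      give no positive constant; here \<open>N\<close> contains at most 0.\<close>
    case True
    have zero: "v = 0" if "v \<in> N" for v
    proof (rule ccontr)
      assume "v \<noteq> 0"
      then have "(1 / norm v) *\<^sub>R v \<in> N \<inter> sphere 0 1"
        using N(2)[OF that, of "1 / norm v"] by simp
      with True show False by blast
    qed
    have "1 * norm v \<le> norm (v + l)" if "v \<in> N" for v l
      using zero[OF that] by simp
    then show ?thesis
      by (rule that[OF zero_less_one])
  next
    case False
    \<comment> \<open>The constant is the distance from the unit vectors of \<open>N\<close> to
      \<open>L\<close>, positive by compactness; homogeneity extends the bound to all of
      \<open>N\<close>.\<close>
    define \<delta> where "\<delta> = setdist (N \<inter> sphere 0 1) L"
    have "compact (N \<inter> sphere 0 1)"
      using N(1) by (intro closed_Int_compact) auto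
    moreover have "N \<inter> sphere 0 1 \<inter> L = {}"
      using NL by auto
    ultimately have "\<delta> > 0"
      using setdist_gt_0_compact_closed[of "N \<inter> sphere 0 1" L] clL False subspace_0[OF L]
      by (auto simp: \<delta>_def)
    moreover have "\<delta> * norm v \<le> norm (v + l)" if "v \<in> N" "l \<in> L" for v l
    proof (cases "v = 0")
      case False
      have "(1 / norm v) *\<^sub>R v \<in> N \<inter> sphere 0 1"
        using N(2)[OF that(1), of "1 / norm v"] False by simp
      moreover have "- (1 / norm v) *\<^sub>R l \<in> L"
        by (intro subspace_scale L that)
      ultimately have "\<delta> \<le> dist ((1 / norm v) *\<^sub>R v) (- (1 / norm v) *\<^sub>R l)"
        unfolding \<delta>_def by (rule setdist_le_dist)
      also have "\<dots> = norm ((1 / norm v) *\<^sub>R (v + l))"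
        by (simp add: dist_norm scaleR_add_right)
      also have "\<dots> = norm (v + l) / norm v"
        by simp
      finally show ?thesis
        using False by (simp add: pos_le_divide_eq)
    qed simp
    ultimately show ?thesis
      by (rule that)
  qed
  show ?thesis
    unfolding closed_sequential_limits
  proof (intro allI impI, elim conjE)
    fix u w
    assume u: "\<forall>n. u n \<in> {v + l |v l. v \<in> N \<and> l \<in> L}" and lim: "u \<longlonglongrightarrow> w"
    then obtain v l where vl: "\<And>n. u n = v n + l n" "\<And>n. v n \<in> N" "\<And>n. l n \<in> L"
      by (auto simp: set_eq_iff) metis
    obtain B where B: "\<And>n. norm (u n) \<le> B"
      using convergent_imp_Bseq[OF convergentI[OF lim]] by (metis BseqE)
    have "norm (v n) \<le> B / \<delta>" for n
      using \<delta>(2)[OF vl(2,3), of n n] B[of n] \<delta>(1) vl(1)[of n]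
      by (simp add: pos_le_divide_eq mult.commute)
    then have "bounded (range v)"
      by (auto simp: bounded_iff)
    then obtain v' r where r: "strict_mono (r :: nat \<Rightarrow> nat)" "(v \<circ> r) \<longlonglongrightarrow> v'"
      using bounded_imp_convergent_subsequence by blast
    have "(\<lambda>n. (u \<circ> r) n - (v \<circ> r) n) \<longlonglongrightarrow> w - v'"
      by (intro tendsto_diff r LIMSEQ_subseq_LIMSEQ[OF lim])
    then have "(l \<circ> r) \<longlonglongrightarrow> w - v'"
      by (simp add: vl(1) o_def)
    then have "w - v' \<in> L"
      by (rule closed_sequentially[OF clL, rotated]) (simp add: vl(3))
    moreover have "v' \<in> N"
      by (rule closed_sequentially[OF N(1) _ r(2)]) (simp add: vl(2))
    ultimately show "w \<in> {v + l |v l. v \<in> N \<and> l \<in> L}"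
      by (intro CollectI exI[of _ v'] exI[of _ "w - v'"]) simp
  qed
qed

lemma infdist_less_obtains:
  assumes "infdist x A < e" "A \<noteq> {}"
  obtains a where "a \<in> A" "dist x a < e"
proof -
  have "\<exists>a\<in>A. dist x a < e"
  proof (rule ccontr)
    assume "\<not> ?thesis"
    then have "e \<le> infdist x A"
      unfolding infdist_notempty[OF assms(2)] by (intro cINF_greatest assms(2)) auto
    with assms(1) show False by simp
  qed
  then show thesis using that by blast
qed

text \<open>Coercivity: every single term \<open>\<bar>x $ i\<bar> powr p\<close> is at most
  \<open>C\<close>, which confines each coordinate.\<close>

lemma bounded_lp_pow_sublevel:
  assumes "p > 0"
  shows "bounded {x :: real ^ 'n. lp_pow p x \<le> C}"
  unfolding bounded_iff
proof (intro exI ballI)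
  fix x :: "real ^ 'n" assume "x \<in> {x. lp_pow p x \<le> C}"
  then have x: "lp_pow p x \<le> C" by simp
  have "\<bar>x $ i\<bar> \<le> C powr (1 / p)" for i
  proof -
    have "\<bar>x $ i\<bar> powr p \<le> lp_pow p x"
      unfolding lp_pow_def by (rule member_le_sum) auto
    with x have "(\<bar>x $ i\<bar> powr p) powr (1 / p) \<le> C powr (1 / p)"
      using assms by (intro powr_mono2) auto
    then show ?thesis
      using assms by (simp add: powr_powr)
  qed
  then have "(\<Sum>i\<in>UNIV. \<bar>x $ i\<bar>) \<le> (\<Sum>i\<in>(UNIV::'n set). C powr (1 / p))"
    by (intro sum_mono)
  then show "norm x \<le> CARD('n) * C powr (1 / p)"
    using norm_le_l1_cart[of x] by simp
qed

text \<open>On \<open>F\<close> the normal cone inequality absorbs the linear term of the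
  subgradient \<open>- v\<close>; off \<open>F\<close> the indicator is infinite. Constant sequences
  carry the resulting Frechet subgradient 0 into the limiting subdifferential.\<close>

lemma stationary_pointI:
  assumes p: "0 < p" "p < 1" and v: "v \<in> normal_cone F x" "- v \<in> lp_subdiff p x"
  shows "stationary_point (lp_pow p) F x"
proof -
  let ?f = "\<lambda>y. ereal (lp_pow p y) + indicator_fn F y"
  have x: "x \<in> F" using v(1) by (simp add: normal_cone_def)
  then have fx: "?f x = ereal (lp_pow p x)"
    by (simp add: indicator_fn_def)
  have "0 \<in> frechet_subdiff ?f x"
    unfolding frechet_subdiff_iff[where f = ?f, OF fx]
  proof (intro allI impI)
    fix e :: real assume "e > 0"
    from lp_subdiff_ineq[OF p v(2) this]
    show "\<forall>\<^sub>F y in at x. ereal (lp_pow p x + 0 \<bullet> (y - x) - e * norm (y - x)) \<le> ?f y"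
    proof (rule eventually_mono)
      fix y assume *: "lp_pow p x + - v \<bullet> (y - x) - e * norm (y - x) \<le> lp_pow p y"
      show "ereal (lp_pow p x + 0 \<bullet> (y - x) - e * norm (y - x)) \<le> ?f y"
      proof (cases "y \<in> F")
        case True
        then have "v \<bullet> (y - x) \<le> 0"
          using v(1) by (simp add: normal_cone_def)
        with * True show ?thesis
          by (simp add: indicator_fn_def)
      qed (simp add: indicator_fn_def)
    qed
  qed
  then have "0 \<in> limiting_subdiff ?f x"
    unfolding limiting_subdiff_def mem_Collect_eq
    by (intro conjI exI[of _ "\<lambda>_. x"] exI[of _ "\<lambda>_. 0"]) (simp_all add: fx)
  with x show ?thesis
    by (simp add: stationary_point_def)
qed

text \<open>The \<open>d k\<close> may be unbounded off the support of \<open>x\<close>, so no limit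
  of them is taken. Only the convergent part \<open>s k\<close> is split off; the rest lies in
  \<open>L\<close>, and closedness of the sum of the normal cone and \<open>L\<close> supplies a
  limit decomposition.\<close>

lemma stationary_point_of_approximate:
  fixes x :: "real ^ 'n"
  assumes p: "0 < p" "p < 1" and xF: "x \<in> F"
    and cq: "uminus ` horizon_subdiff (\<lambda>y. ereal (lp_pow p y)) x \<inter> normal_cone F x = {0}"
    and y: "y \<longlonglongrightarrow> x" and d: "\<And>k. d k \<in> lp_subdiff p (y k)"
    and v: "\<forall>\<^sub>F k in sequentially. v k \<in> normal_cone F x"
    and dv: "(\<lambda>k. d k + v k) \<longlonglongrightarrow> 0"
  shows "stationary_point (lp_pow p) F x"
proof -
  define L where "L = {l :: real ^ 'n. \<forall>i. x $ i \<noteq> 0 \<longrightarrow> l $ i = 0}"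
  define s where "s k = (\<chi> i. if x $ i \<noteq> 0 then powr_deriv p (y k $ i) else 0)" for k
  define s' where "s' = (\<chi> i. if x $ i \<noteq> 0 then powr_deriv p (x $ i) else 0)"
  have yi: "(\<lambda>k. y k $ i) \<longlonglongrightarrow> x $ i" for i
    using y by (intro tendsto_intros)
  have L: "subspace L"
    by (auto simp: L_def subspace_def)
  have "normal_cone F x \<inter> L \<subseteq> {0}"
  proof
    fix l assume l: "l \<in> normal_cone F x \<inter> L"
    then have "- l \<in> horizon_subdiff (\<lambda>y. ereal (lp_pow p y)) x"
      by (intro horizon_subdiff_lp_pow_superset p) (auto simp: L_def)
    then have "l \<in> uminus ` horizon_subdiff (\<lambda>y. ereal (lp_pow p y)) x"
      by (metis imageI minus_minus)
    with l cq show "l \<in> {0}" by blast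
  qed
  then have cl: "closed {v + l |v l. v \<in> normal_cone F x \<and> l \<in> L}"
    by (intro closed_sum_cone_subspace closed_normal_cone normal_cone_scaleR L)
  have s: "s \<longlonglongrightarrow> s'"
  proof (rule vec_tendstoI)
    fix i
    show "(\<lambda>k. s k $ i) \<longlonglongrightarrow> s' $ i"
      using isCont_tendsto_compose[OF continuous_powr_deriv yi, of i]
      by (cases "x $ i = 0") (simp_all add: s_def s'_def)
  qed
  have "\<forall>\<^sub>F k in sequentially. \<forall>i. x $ i \<noteq> 0 \<longrightarrow> y k $ i \<noteq> 0"
    by (intro eventually_all_finite) (use tendsto_imp_eventually_ne[OF yi] in \<open>auto elim: eventually_mono\<close>)
  then have dL: "\<forall>\<^sub>F k in sequentially. d k - s k \<in> L"
    by (rule eventually_mono) (use d in \<open>auto simp: L_def s_def lp_subdiff_def\<close>)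
  have "- s' \<in> {v + l |v l. v \<in> normal_cone F x \<and> l \<in> L}"
  proof (rule Lim_in_closed_set[OF cl])
    show "(\<lambda>k. (d k + v k) - s k) \<longlonglongrightarrow> - s'"
      using tendsto_diff[OF dv s] by simp
    from v dL show "\<forall>\<^sub>F k in sequentially.
        (d k + v k) - s k \<in> {v + l |v l. v \<in> normal_cone F x \<and> l \<in> L}"
    proof eventually_elim
      case (elim k)
      then show ?case
        by (intro CollectI exI[of _ "v k"] exI[of _ "d k - s k"]) simp
    qed
  qed simp
  then obtain u l where u: "u \<in> normal_cone F x" and l: "l \<in> L" and eq: "- s' = u + l"
    by blast
  \<comment> \<open>On the support of \<open>x\<close> the vector \<open>l\<close> vanishes, leaving
    the derivative values of \<open>s'\<close>; elsewhere \<open>lp_subdiff\<close> imposes no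
    condition.\<close>
  have "- u = s' + l"
    using eq by (metis add.inverse_inverse minus_add_cancel minus_add_distrib add.commute)
  then have "- u \<in> lp_subdiff p x"
    using l by (simp add: lp_subdiff_def L_def s'_def)
  with u show ?thesis
    by (rule stationary_pointI[OF p])
qed

section \<open>Bounds along the iteration and properties of cluster points\<close>

theorem theorem3p1:
  fixes p \<sigma> \<rho> \<theta> :: real
    and A :: "real ^ 'n ^ 'm"
    and b :: "real ^ 'm"
    and x :: "nat \<Rightarrow> real ^ 'n"
  assumes "0 < p" and "p < 1"
    and "\<sigma> \<ge> 0"
    and "feasible_set A b \<sigma> \<noteq> {}"
    and "l1_norm b > \<sigma>"
    and "\<rho> > 1" and "0 < \<theta>" and "\<theta> < 1"
    and "\<theta> * \<rho> \<le> 1"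
    and "SPeL1_sequence (lp_pow p) A b \<sigma> \<rho> \<theta> x"
  shows "bounded (range x) \<and>
    (\<forall>xs. cluster_point x xs \<longrightarrow> xs \<in> feasible_set A b \<sigma>) \<and>
    (\<forall>xs. cluster_point x xs \<and>
        uminus ` horizon_subdiff (\<lambda>y. ereal (lp_pow p y)) xs
          \<inter> normal_cone (feasible_set A b \<sigma>) xs = {0} \<longrightarrow>
        stationary_point (lp_pow p) (feasible_set A b \<sigma>) xs)"
proof -
  note p = assms(1,2)
  let ?F = "feasible_set A b \<sigma>"
  obtain xfeas lam \<mu> \<nu> \<epsilon> w l where
    feas: "xfeas \<in> ?F" and
    init: "lam 0 > 0" "\<mu> 0 > 0" "\<nu> 0 > 0" "\<epsilon> 0 > 0" "x 0 = xfeas" and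
    step: "\<And>k. w k 0 =
          (if F_penalty (lp_pow p) A b \<sigma> (lam k) (\<mu> k) (\<nu> k) (x k)
              \<le> F_penalty (lp_pow p) A b \<sigma> (lam k) (\<mu> k) (\<nu> k) xfeas
           then x k else xfeas)"
      "\<And>k. limiting_subdiff (\<lambda>y. ereal (lp_pow p y)) (w k (Suc (l k))) \<noteq> {}"
      "\<And>k. infdist 0
          ((\<lambda>d. d + gradient (f_penalty A b \<sigma> (lam k) (\<mu> k) (\<nu> k)) (w k (l k)))
            ` limiting_subdiff (\<lambda>y. ereal (lp_pow p y)) (w k (Suc (l k)))) \<le> \<epsilon> k"
      "\<And>k. norm (w k (Suc (l k)) - w k (l k)) \<le> \<epsilon> k"
      "\<And>k. F_penalty (lp_pow p) A b \<sigma> (lam k) (\<mu> k) (\<nu> k) (w k (l k))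
          - F_penalty (lp_pow p) A b \<sigma> (lam k) (\<mu> k) (\<nu> k) (w k 0) \<le> 0"
      "\<And>k. x (Suc k) = w k (l k)" and
    upd: "\<And>k. lam (Suc k) = \<rho> * lam k" "\<And>k. \<mu> (Suc k) = \<theta> * \<mu> k"
      "\<And>k. \<nu> (Suc k) = \<theta> * \<nu> k" "\<And>k. \<epsilon> (Suc k) = \<theta> * \<epsilon> k"
    using assms(10) unfolding SPeL1_sequence_def by blast
  have lam_eq: "lam k = lam 0 * \<rho> ^ k" for k by (induction k) (simp_all add: upd)
  have \<mu>_eq: "\<mu> k = \<mu> 0 * \<theta> ^ k" for k by (induction k) (simp_all add: upd)
  have \<nu>_eq: "\<nu> k = \<nu> 0 * \<theta> ^ k" for k by (induction k) (simp_all add: upd)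
  have \<epsilon>_eq: "\<epsilon> k = \<epsilon> 0 * \<theta> ^ k" for k by (induction k) (simp_all add: upd)
  have pos: "lam k > 0" "\<mu> k > 0" "\<nu> k > 0" "\<epsilon> k > 0" for k
    unfolding lam_eq[of k] \<mu>_eq[of k] \<nu>_eq[of k] \<epsilon>_eq[of k] using init assms(6,7) by simp_all
  have "(\<lambda>k. \<theta> ^ k) \<longlonglongrightarrow> 0"
    using assms(7,8) by (intro LIMSEQ_realpow_zero) auto
  then have "(\<lambda>k. \<mu> 0 * \<theta> ^ k) \<longlonglongrightarrow> 0" "(\<lambda>k. \<nu> 0 * \<theta> ^ k) \<longlonglongrightarrow> 0"
    "(\<lambda>k. \<epsilon> 0 * \<theta> ^ k) \<longlonglongrightarrow> 0"
    by (rule tendsto_mult_right_zero)+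
  then have lim: "\<mu> \<longlonglongrightarrow> 0" "\<nu> \<longlonglongrightarrow> 0" "\<epsilon> \<longlonglongrightarrow> 0"
    by (simp_all flip: \<mu>_eq \<nu>_eq \<epsilon>_eq)
  \<comment> \<open>Here \<open>\<theta> * \<rho> \<le> 1\<close> enters: the decay of the smoothing
    parameters compensates the growth of the penalty weight.\<close>
  have lam_le: "lam k * \<mu> k \<le> lam 0 * \<mu> 0" "lam k * \<nu> k \<le> lam 0 * \<nu> 0" for k
  proof -
    have le1: "(\<theta> * \<rho>) ^ k \<le> 1"
      using assms(6,7,9) by (intro power_le_one) auto
    show "lam k * \<mu> k \<le> lam 0 * \<mu> 0"
      using mult_left_mono[OF le1, of "lam 0 * \<mu> 0"] init
      unfolding lam_eq[of k] \<mu>_eq[of k] by (simp add: power_mult_distrib mult_ac)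
    show "lam k * \<nu> k \<le> lam 0 * \<nu> 0"
      using mult_left_mono[OF le1, of "lam 0 * \<nu> 0"] init
      unfolding lam_eq[of k] \<nu>_eq[of k] by (simp add: power_mult_distrib mult_ac)
  qed
  \<comment> \<open>A bound, uniform in \<open>k\<close>, for the penalized objective at
    \<open>xfeas\<close>, with the products replaced by their initial values.\<close>
  define C where "C = lp_pow p xfeas + real CARD('m) * (lam 0 * \<nu> 0) / 4 + lam 0 * \<mu> 0 / 8"
  have bound: "lp_pow p (x (Suc k)) + lam k * max (l1_norm (A *v x (Suc k) - b) - \<sigma>) 0 \<le> C" for k
  proof -
    let ?G = "F_penalty (lp_pow p) A b \<sigma> (lam k) (\<mu> k) (\<nu> k)"
    have "lp_pow p (x (Suc k)) + lam k * max (l1_norm (A *v x (Suc k) - b) - \<sigma>) 0 \<le> ?G (x (Suc k))"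
      using f_penalty_lower[OF pos(1-3)] by (simp add: F_penalty_def)
    \<comment> \<open>Either branch of the restart rule starts at a value no larger than that at
      \<open>xfeas\<close>, and the inner method ends no higher than it starts. Comparing with
      \<open>xfeas\<close> instead of the previous iterate keeps the bound independent of the
      parameter changes.\<close>
    also have "\<dots> \<le> ?G xfeas"
      using step(1,5)[of k] by (auto simp: step(6) split: if_splits)
    also have "\<dots> \<le> lp_pow p xfeas + (real CARD('m) * (lam k * \<nu> k) / 4 + lam k * \<mu> k / 8)"
      using f_penalty_upper_feasible[OF pos(1-3) feas, of k k k] by (simp add: F_penalty_def)
    also have "\<dots> \<le> C"
    proof -
      have "real CARD('m) * (lam k * \<nu> k) \<le> real CARD('m) * (lam 0 * \<nu> 0)"
        by (intro mult_left_mono lam_le) simp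
      with lam_le(1)[of k] show ?thesis unfolding C_def by linarith
    qed
    finally show ?thesis .
  qed
  have bdd: "bounded (range x)"
  proof (rule bounded_subset[OF bounded_lp_pow_sublevel[OF p(1), of C]], safe)
    fix k
    show "lp_pow p (x k) \<le> C"
    proof (cases k)
      case 0
      then show ?thesis
        using init by (simp add: C_def)
    next
      case (Suc j)
      have "0 \<le> lam j * max (l1_norm (A *v x (Suc j) - b) - \<sigma>) 0"
        using pos(1)[of j] by simp
      with bound[of j] Suc show ?thesis by simp
    qed
  qed
  \<comment> \<open>The estimates concern \<open>x (Suc k)\<close> with the parameters of stage
    \<open>k\<close>. Dropping the first term of the subsequence makes its indices positive, so each
    can be written as a successor.\<close>
  have subseq: "\<exists>q. strict_mono q \<and> (\<lambda>k. x (Suc (q k))) \<longlonglongrightarrow> xs" if cl: "cluster_point x xs" for xs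
  proof -
    obtain r where r: "strict_mono r" "(x \<circ> r) \<longlonglongrightarrow> xs"
      using cl by (auto simp: cluster_point_def)
    have "r (Suc j) > 0" for j
      using seq_suble[OF r(1), of "Suc j"] by simp
    then have S: "Suc (r (Suc j) - 1) = r (Suc j)" for j by simp
    have "r (Suc i) - 1 < r (Suc j) - 1" if "i < j" for i j
      using strict_monoD[OF r(1), of "Suc i" "Suc j"] that S[of i] by linarith
    then have "strict_mono (\<lambda>j. r (Suc j) - 1)"
      by (auto simp: strict_mono_def)
    moreover have "(\<lambda>j. x (Suc (r (Suc j) - 1))) \<longlonglongrightarrow> xs"
      using LIMSEQ_Suc[OF r(2)] by (simp only: S o_def)
    ultimately show ?thesis by blast
  qed
  have feasible: "xs \<in> ?F" if cl: "cluster_point x xs" for xs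
  proof -
    obtain q where q: "strict_mono q" "(\<lambda>k. x (Suc (q k))) \<longlonglongrightarrow> xs"
      using subseq[OF cl] by blast
    \<comment> \<open>The violation at \<open>x (Suc k)\<close> is at most \<open>C / lam k\<close>,
      which decays geometrically.\<close>
    have "(\<lambda>k. (C / lam 0) * (1 / \<rho>) ^ k) \<longlonglongrightarrow> 0"
      using assms(6) by (intro tendsto_mult_right_zero LIMSEQ_realpow_zero) auto
    moreover have "(C / lam 0) * (1 / \<rho>) ^ k = C / lam k" for k
      by (simp add: lam_eq[of k] power_one_over)
    ultimately have "(\<lambda>k. C / lam k) \<longlonglongrightarrow> 0" by simp
    from LIMSEQ_subseq_LIMSEQ[OF this q(1)]
    have "(\<lambda>k. C / lam (q k)) \<longlonglongrightarrow> 0" by (simp add: o_def)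
    moreover have "(\<lambda>k. l1_norm (A *v x (Suc (q k)) - b) - \<sigma>) \<longlonglongrightarrow> l1_norm (A *v xs - b) - \<sigma>"
      by (intro tendsto_intros tendsto_l1_norm_residual q)
    moreover have "l1_norm (A *v x (Suc k) - b) - \<sigma> \<le> C / lam k" for k
    proof -
      have "0 \<le> lp_pow p (x (Suc k))"
        by (simp add: lp_pow_def sum_nonneg)
      then have "lam k * max (l1_norm (A *v x (Suc k) - b) - \<sigma>) 0 \<le> C"
        using bound[of k] by linarith
      then have "max (l1_norm (A *v x (Suc k) - b) - \<sigma>) 0 \<le> C / lam k"
        using pos(1)[of k] by (simp only: pos_le_divide_eq mult.commute)
      then show ?thesis by simp
    qed
    ultimately have "l1_norm (A *v xs - b) - \<sigma> \<le> 0"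
      by (intro LIMSEQ_le[of _ _ "\<lambda>k. C / lam (q k)"]) auto
    then show ?thesis by (simp add: feasible_set_def)
  qed
  have stationary: "stationary_point (lp_pow p) ?F xs"
    if cl: "cluster_point x xs"
      and cq: "uminus ` horizon_subdiff (\<lambda>y. ereal (lp_pow p y)) xs \<inter> normal_cone ?F xs = {0}" for xs
  proof -
    obtain q where q: "strict_mono q" "(\<lambda>k. x (Suc (q k))) \<longlonglongrightarrow> xs"
      using subseq[OF cl] by blast
    define v where "v k = gradient (f_penalty A b \<sigma> (lam k) (\<mu> k) (\<nu> k)) (x (Suc k))" for k
    \<comment> \<open>The penalty gradient and the subgradient of the objective are taken at
      consecutive inner iterates; their distance is at most \<open>\<epsilon> k\<close>, so both
      sequences approach \<open>xs\<close> along the subsequence.\<close>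
    define y where "y k = w k (Suc (l k))" for k
    have "\<exists>d. d \<in> lp_subdiff p (y k) \<and> norm (d + v k) \<le> 2 * \<epsilon> k" for k
    proof -
      let ?S = "(\<lambda>d. d + v k) ` limiting_subdiff (\<lambda>y. ereal (lp_pow p y)) (y k)"
      \<comment> \<open>Doubling the positive tolerance makes the inequality strict, so a suitable
        element exists without appeal to attainment of the infimum.\<close>
      have "infdist 0 ?S < 2 * \<epsilon> k"
        using step(3)[of k] pos(4)[of k] by (simp add: v_def y_def step(6))
      moreover have "?S \<noteq> {}"
        using step(2)[of k] by (simp add: y_def)
      ultimately obtain a where "a \<in> ?S" "dist 0 a < 2 * \<epsilon> k"
        by (rule infdist_less_obtains)
      then show ?thesis
        using limiting_subdiff_lp_pow_subset[OF p] by fastforce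
    qed
    then obtain d where d: "\<And>k. d k \<in> lp_subdiff p (y k)" "\<And>k. norm (d k + v k) \<le> 2 * \<epsilon> k"
      by metis
    have lim_q: "(\<lambda>k. \<mu> (q k)) \<longlonglongrightarrow> 0" "(\<lambda>k. \<nu> (q k)) \<longlonglongrightarrow> 0" "(\<lambda>k. \<epsilon> (q k)) \<longlonglongrightarrow> 0"
      using lim[THEN LIMSEQ_subseq_LIMSEQ, OF q(1)] by (simp_all add: o_def)
    have "(\<lambda>k. y (q k) - x (Suc (q k))) \<longlonglongrightarrow> 0"
      by (rule Lim_null_comparison[OF _ lim_q(3)]) (simp add: y_def step(4,6))
    from tendsto_add[OF this q(2)] have yq: "(\<lambda>k. y (q k)) \<longlonglongrightarrow> xs" by simp
    have dv: "(\<lambda>k. d (q k) + v (q k)) \<longlonglongrightarrow> 0"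
    proof (rule Lim_null_comparison)
      show "(\<lambda>k. 2 * \<epsilon> (q k)) \<longlonglongrightarrow> 0"
        using lim_q(3) by (rule tendsto_mult_right_zero)
    qed (simp add: d(2))
    have "\<forall>\<^sub>F k in sequentially. v (q k) \<in> normal_cone ?F xs"
      unfolding v_def
      by (rule gradient_f_penalty_eventually_normal[OF q(2) feasible[OF cl] pos(1-3) lim_q(1,2)])
    from stationary_point_of_approximate[OF p feasible[OF cl] cq yq d(1) this dv]
    show ?thesis .
  qed
  show ?thesis
    using bdd feasible stationary by blast
qed

end
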